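(* Let $\ell\ge3$ and $t\ge1$ be integers with $\log_2 t<\ell-1$, let $n=2^\ell$ and $k=\sum_{i=1}^{t}f_\ell^{(t)}(i)$. Then the encoding map $\phi_t:\{0,1\}^k\to\{0,1\}^n$ associated with $f_\ell^{(t)}$ is one-to-one and every vector in its image has Hamming weight $t$; hence $\mathcal{C}_t[\ell]=\phi_t(\{0,1\}^k)$ is a binary constant weight code of blocklength $2^\ell$, weight $t$ and size $2^k$. Moreover, for every $\mathbf{x}\in\{0,1\}^k$ the decoding algorithm described in the context outputs $\mathbf{x}$ on input $\phi_t(\mathbf{x})$. Finally, for $t=2$ and every $\ell\ge3$ one has $k=2\ell-2=\left\lfloor\log_2\binom{2^\ell}{2}\right\rfloor$, so that $\mathcal{C}_2[\ell]$ has the largest possible $k$.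
   Context: The sequence $f_\ell^{(t)}(1),\dots,f_\ell^{(t)}(t)$: if $t$ is not a power of $2$, put $\mu_t=2^{\lceil\log_2 t\rceil}-t$ and $f_\ell^{(t)}(i)=\ell-\lceil\log_2 t\rceil$ for $1\le i\le t-\mu_t$; $f_\ell^{(t)}(i)=\ell-\lfloor\log_2 t\rfloor$ for $t-\mu_t+1\le i\le t-1$; $f_\ell^{(t)}(t)=\ell$. If $t\ge2$ is a power of $2$, put $f_\ell^{(t)}(1)=\ell-\log_2 t-1$; $f_\ell^{(t)}(i)=\ell-\log_2 t$ for $2\le i\le t-1$; $f_\ell^{(t)}(t)=\ell$. If $t=1$, put $f_\ell^{(1)}(1)=\ell$. For a binary vector $\mathbf{y}$, $\mathrm{dec}(\mathbf{y})$ is its decimal value, most significant bit first. For a vector $\mathbf{g}=(g[0],\dots,g[t-1])$ and $m_0\in\{0,\dots,t-1\}$, $\mathrm{cshift}(\mathbf{g},m_0)=(g[m_0],\dots,g[t-1],g[0],\dots,g[m_0-1])$. Encoding map $\phi_t$ with $n=2^\ell$: write $\mathbf{x}=\mathbf{x}_t\Vert\mathbf{x}_{t-1}\Vert\cdots\Vert\mathbf{x}_1$ (concatenation) with $|\mathbf{x}_i|=f_\ell^{(t)}(i)$. Start with $\mathbf{c}=0^n$ (coordinates indexed $0,\dots,n-1$) and $\mathrm{pos}=-1$. For $j=t,t-1,\dots,1$ in this order, replace $\mathrm{pos}$ by $(\mathrm{pos}+1+\mathrm{dec}(\mathbf{x}_j))\bmod n$ and set $c[\mathrm{pos}]=1$.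 Output $\phi_t(\mathbf{x})=\mathbf{c}$. Decoding algorithm: given $\mathbf{c}$ with ones at positions $0\le j[0]<\cdots<j[t-1]<n$, put $\mathbf{g}[m]=(j[m]-j[(m-1)\bmod t]-1)\bmod n$ for $0\le m\le t-1$. Let $\boldsymbol\gamma=\left(2^\ell-1-\sum_{i=1}^{t-1}2^{f_\ell^{(t)}(i)},\ 2^{f_\ell^{(t)}(t-1)}-1,\dots,2^{f_\ell^{(t)}(1)}-1\right)$, a vector of length $t$. If $\mathrm{cshift}(\mathbf{g},m_0)=\boldsymbol\gamma$ for some $m_0\in\{0,\dots,t-1\}$, set $A=m_0$; otherwise set $A=\arg\max_{0\le m\le t-1}\mathbf{g}[m]$. Output the length-$\ell$ binary representation of $j[A]$ followed, for $i=1,\dots,t-1$ in this order, by the binary representation of $\mathbf{g}[(A+i)\bmod t]$ of length $f_\ell^{(t)}(t-i)$. *)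

theory Defs
  imports Complex_Main
begin

text \<open>
  Bits are booleans and binary vectors are lists of booleans, written in the order of
  their coordinates.
\<close>

definition bvec :: "nat \<Rightarrow> bool list set" where
  "bvec k = {x. length x = k}"

definition hamming_weight :: "bool list \<Rightarrow> nat" where
  "hamming_weight c = card {i. i < length c \<and> c ! i}"

definition constant_weight_code :: "nat \<Rightarrow> nat \<Rightarrow> bool list set \<Rightarrow> bool" where
  "constant_weight_code n w C \<longleftrightarrow> C \<subseteq> bvec n \<and> (\<forall>c\<in>C. hamming_weight c = w)"

text \<open>
  Both conversions have the most significant bit first, whereas \<^const>\<open>horner_sum\<close> and
  \<^const>\<open>bit\<close> count from the least significant one.
\<close>

definition dec :: "bool list \<Rightarrow> int" where
  "dec y = horner_sum of_bool 2 (rev y)"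

definition bin_rep :: "nat \<Rightarrow> int \<Rightarrow> bool list" where
  "bin_rep w v = rev (map (bit v) [0..<w])"

text \<open>
  The subtractions on naturals below do not truncate when \<open>log 2 t < l - 1\<close>.  The value
  \<open>fseq l t i\<close> is meaningful for \<open>1 \<le> i \<le> t\<close> only.
\<close>

definition mu :: "nat \<Rightarrow> nat" where
  "mu t = 2 ^ nat \<lceil>log 2 (real t)\<rceil> - t"

definition fseq :: "nat \<Rightarrow> nat \<Rightarrow> nat \<Rightarrow> nat" where
  "fseq l t i =
     (if t = 1 then l
      else if \<exists>r::nat. t = 2 ^ r then
        (if i = t then l
         else if i = 1 then l - nat \<lfloor>log 2 (real t)\<rfloor> - 1
         else l - nat \<lfloor>log 2 (real t)\<rfloor>)
      else
        (if i = t then l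
         else if i \<le> t - mu t then l - nat \<lceil>log 2 (real t)\<rceil>
         else l - nat \<lfloor>log 2 (real t)\<rfloor>))"

definition msg_len :: "nat \<Rightarrow> nat \<Rightarrow> nat" where
  "msg_len l t = (\<Sum>i=1..t. fseq l t i)"

text \<open>
  \<open>block l t x j\<close> is the part \<open>x\<^sub>j\<close> of \<open>x = x\<^sub>t @ \<dots> @ x\<^sub>1\<close>, where \<open>x\<^sub>i\<close> has length
  \<open>fseq l t i\<close>.
\<close>

definition block :: "nat \<Rightarrow> nat \<Rightarrow> bool list \<Rightarrow> nat \<Rightarrow> bool list" where
  "block l t x j = take (fseq l t j) (drop (\<Sum>i=j+1..t. fseq l t i) x)"

definition enc_step ::
    "nat \<Rightarrow> nat \<Rightarrow> bool list \<Rightarrow> nat \<Rightarrow> int \<times> bool list \<Rightarrow> int \<times> bool list" where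
  "enc_step l t x j = (\<lambda>(pos, c).
     let pos' = (pos + 1 + dec (block l t x j)) mod 2 ^ l
     in (pos', c[nat pos' := True]))"

definition encode :: "nat \<Rightarrow> nat \<Rightarrow> bool list \<Rightarrow> bool list" where
  "encode l t x =
     snd (fold (enc_step l t x) (rev [1..<t+1]) (- 1, replicate (2 ^ l) False))"

definition code :: "nat \<Rightarrow> nat \<Rightarrow> bool list set" where
  "code l t = encode l t ` bvec (msg_len l t)"

definition ones :: "bool list \<Rightarrow> nat list" where
  "ones c = filter (\<lambda>i. c ! i) [0..<length c]"

definition gaps :: "nat \<Rightarrow> nat \<Rightarrow> bool list \<Rightarrow> int list" where
  "gaps l t c = map (\<lambda>m.
     (int (ones c ! m) - int (ones c ! nat ((int m - 1) mod int t)) - 1) mod 2 ^ l) [0..<t]"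

definition gamma :: "nat \<Rightarrow> nat \<Rightarrow> int list" where
  "gamma l t = (2 ^ l - 1 - (\<Sum>i=1..<t. 2 ^ fseq l t i))
     # map (\<lambda>i. 2 ^ fseq l t i - 1) (rev [1..<t])"

text \<open>
  Neither \<open>m\<^sub>0\<close> nor the maximizer of the gaps need be unique for an arbitrary input, so the
  index \<open>A\<close>, and with it the output of the decoder, is described by a relation that admits
  every choice.  The cyclic shift by \<open>m\<close> is \<^term>\<open>rotate m\<close>.
\<close>

definition anchor :: "nat \<Rightarrow> nat \<Rightarrow> bool list \<Rightarrow> nat \<Rightarrow> bool" where
  "anchor l t c A \<longleftrightarrow>
     (if \<exists>m0<t. rotate m0 (gaps l t c) = gamma l t
      then A < t \<and> rotate A (gaps l t c) = gamma l t
      else is_arg_max (\<lambda>m. gaps l t c ! m) (\<lambda>m. m < t) A)"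

definition decoder_outputs :: "nat \<Rightarrow> nat \<Rightarrow> bool list \<Rightarrow> bool list \<Rightarrow> bool" where
  "decoder_outputs l t c y \<longleftrightarrow>
     (\<exists>A. anchor l t c A \<and>
        y = bin_rep l (int (ones c ! A))
            @ concat (map (\<lambda>i. bin_rep (fseq l t (t - i)) (gaps l t c ! ((A + i) mod t)))
                [1..<t]))"

end

theory Submission
  imports Defs
begin

text \<open>
  Read cyclically from the first position that the encoder marks, the gaps between consecutive
  ones of a codeword are \<open>G, d\<^sub>t\<^sub>-\<^sub>1, \<dots>, d\<^sub>1\<close>, where \<open>d\<^sub>j\<close> is the value of the block \<open>x\<^sub>j\<close> and the
  wrap-around gap \<open>G\<close> makes the sum equal to \<open>2\<^sup>l - t\<close>.  As \<open>d\<^sub>j < 2\<^bsup>f(j)\<^esup>\<close>, \<open>G\<close> is at least the first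
  entry of \<open>gamma\<close>, which is at least all the other entries of \<open>gamma\<close>, hence at least every
  \<open>d\<^sub>j\<close>.  So either \<open>G\<close> is the strict maximum, or all blocks are maximal and the cyclic gap
  vector is \<open>gamma\<close> itself.  In the latter case \<open>gamma\<close> is non-increasing with its last entry smaller
  than its first one, so no proper rotation fixes it.  In both cases the decoder locates the
  first marked position.
\<close>

section \<open>Two-level shape of the exponent sequence\<close>

text \<open>Here \<open>s = 1\<close> if \<open>t = 2 ^ r\<close>, and \<open>s = t - mu t\<close> otherwise.\<close>

lemma fseq_two_level:
  assumes "2 \<le> t" and "log 2 (real t) < real l - 1"
  obtains e r s where "l = e + r + 1" and "1 \<le> s" and "s < t" and "2 * t \<le> 2 ^ (r + 1) + s"
    and "\<And>i. 1 \<le> i \<Longrightarrow> i < t \<Longrightarrow> fseq l t i = (if i \<le> s then e else Suc e)"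
proof (cases "\<exists>r::nat. t = 2 ^ r")
  case True
  then obtain r where r: "t = 2 ^ r" by blast
  have rl: "r + 1 < l" using assms(2) by (simp add: r)
  show ?thesis
  proof (rule that[of "l - r - 1" r 1])
    show "fseq l t i = (if i \<le> 1 then l - r - 1 else Suc (l - r - 1))" if "1 \<le> i" "i < t" for i
      using that True assms(1) rl by (auto simp: fseq_def r)
  qed (use rl assms(1) in \<open>auto simp: r\<close>)
next
  case False
  obtain r where "2 ^ r \<le> t" and t_less: "t < 2 ^ (r + 1)"
    using ex_power_ivl1[of 2 t] assms(1) by auto
  with False have less_t: "2 ^ r < t" by (metis le_neq_implies_less)
  have fl: "\<lfloor>log 2 (real t)\<rfloor> = int r"
    using floor_log_nat_eq_if[of 2 r t] less_t t_less by simp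
  have cl: "\<lceil>log 2 (real t)\<rceil> = int (r + 1)"
    using ceiling_log_nat_eq_if[of 2 r t] less_t t_less by simp
  have "real r < real l - 1" using fl assms(2) by linarith
  then have rl: "r + 1 < l" by linarith
  have mu: "mu t = 2 ^ (r + 1) - t" unfolding mu_def cl nat_int ..
  show ?thesis
  \<comment> \<open>Here \<open>s = 2 * t - 2 ^ (r + 1)\<close>, so the bound on
    \<open>2 * t\<close> holds with equality.\<close>
  proof (rule that[of "l - r - 1" r "t - mu t"])
    show "fseq l t i = (if i \<le> t - mu t then l - r - 1 else Suc (l - r - 1))"
      if "1 \<le> i" "i < t" for i
      using that False assms(1) rl unfolding fseq_def fl cl by auto
  qed (use rl less_t t_less mu in auto)
qed

section \<open>Binary expansions\<close>

lemma dec_bounds: "0 \<le> dec y" "dec y < 2 ^ length y"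
proof -
  have "dec y = take_bit (length y) (dec y)"
    by (auto simp: dec_def bit_eq_iff bit_take_bit_iff bit_horner_sum_bit_iff)
  then show "0 \<le> dec y" "dec y < 2 ^ length y"
    by (metis take_bit_nonnegative, metis take_bit_int_less_exp)
qed

lemma bin_rep_dec: "bin_rep (length y) (dec y) = y"
  by (rule nth_equalityI)
    (auto simp: bin_rep_def dec_def rev_nth bit_horner_sum_bit_iff)

section \<open>Rotations of sorted lists\<close>

text \<open>With \<open>k = m mod length xs\<close> nonzero, invariance sends index \<open>0\<close>
  to \<open>k\<close> and the last index to \<open>k - 1\<close>. The first entry would then be
  \<open>xs ! k\<close>, at most \<open>xs ! (k - 1)\<close>, which is the last entry.\<close>

lemma rotate_descending_eq:
  fixes xs :: "'a::linorder list"
  assumes "sorted_wrt (\<ge>) xs" and "xs \<noteq> []" and "last xs < hd xs" and "rotate m xs = xs"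
  shows "m mod length xs = 0"
proof (rule ccontr)
  let ?n = "length xs" and ?k = "m mod length xs"
  assume k: "?k \<noteq> 0"
  note ne = assms(2)
  have kn: "?k < ?n" using ne by simp
  have nth: "xs ! i = xs ! ((m + i) mod ?n)" if "i < ?n" for i
    using nth_rotate[of i xs m] that assms(4) by simp
  have "xs ! 0 = xs ! ?k" using nth[of 0] ne by simp
  also have "\<dots> \<le> xs ! (?k - 1)"
    using sorted_wrt_nth_less[OF assms(1), of "?k - 1" ?k] k kn by simp
  also have "(m + (?n - 1)) mod ?n = ?k - 1"
  proof -
    have "(m + (?n - 1)) mod ?n = (?k + (?n - 1)) mod ?n" by (simp add: mod_add_left_eq)
    also have "?k + (?n - 1) = ?k - 1 + ?n" using k kn by simp
    also have "\<dots> mod ?n = ?k - 1" using kn by simp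
    finally show ?thesis .
  qed
  then have "xs ! (?k - 1) = xs ! (?n - 1)" using nth[of "?n - 1"] ne by simp
  finally show False using assms(3) ne by (simp add: hd_conv_nth last_conv_nth)
qed

text \<open>The values of \<open>q\<close> start in the interval from \<open>0\<close> to
  \<open>n\<close> and span less than one turn, so reduction modulo \<open>n\<close> wraps at most
  once. The wrapped residues \<open>q i - n\<close> lie below \<open>q 0\<close>, hence moving them
  to the front sorts the list.\<close>

lemma rotate_sorts_residues:
  fixes q :: "nat \<Rightarrow> int"
  assumes mono: "\<And>i j. i < j \<Longrightarrow> j < t \<Longrightarrow> q i < q j"
    and "0 \<le> q 0" and "q 0 < n" and "q (t - 1) < q 0 + n"
  obtains s where "sorted_wrt (<) (rotate s (map (\<lambda>m. nat (q m mod n)) [0..<t]))"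
proof -
  \<comment> \<open>The first index at which \<open>q\<close> has wrapped, or \<open>t\<close> if it
    never does.\<close>
  define p where "p = (LEAST m. m = t \<or> n \<le> q m)"
  define xs where "xs = map (\<lambda>m. nat (q m mod n)) [0..<t]"
  have pt: "p \<le> t" unfolding p_def by (rule Least_le) simp
  have below: "q m < n" if "m < p" for m
    using not_less_Least[of m "\<lambda>m. m = t \<or> n \<le> q m"] that by (auto simp: p_def)
  have "p = t \<or> n \<le> q p" unfolding p_def by (rule LeastI[of _ t]) simp
  then have above: "n \<le> q m" if "p \<le> m" "m < t" for m
    using mono[of p m] that by (cases "p = m") auto
  have q0: "q 0 \<le> q m" if "m < t" for m using mono[of 0 m] that by (cases "m = 0") auto
  have top: "q m < q 0 + n" if "m < t" for m
    using mono[of m "t - 1"] that assms(4) by (cases "m < t - 1")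
      (auto simp: not_less le_less_Suc_eq dest: le_antisym)
  have lo: "q m mod n = q m" if "m < p" for m
    using below[OF that] q0[of m] that pt assms(2) by simp
  have hi: "q m mod n = q m - n" if "p \<le> m" "m < t" for m
  proof -
    have "0 \<le> q m - n" "q m - n < n" using above[OF that] top[OF that(2)] assms(3) by auto
    then show ?thesis by (metis minus_mod_self2 mod_pos_pos_trivial)
  qed
  have "sorted_wrt (<) (drop p xs @ take p xs)"
    unfolding sorted_wrt_append
  proof (intro conjI ballI)
    show "sorted_wrt (<) (drop p xs)"
      unfolding sorted_wrt_iff_nth_less
    proof (intro allI impI)
      fix i j assume "i < j" "j < length (drop p xs)"
      then have ij: "p + i < t" "p + j < t" "p + i < p + j" by (auto simp: xs_def)
      then show "drop p xs ! i < drop p xs ! j"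
        using mono[of "p + i" "p + j"] above[of "p + i"]
        by (simp add: xs_def hi)
    qed
    show "sorted_wrt (<) (take p xs)"
      unfolding sorted_wrt_iff_nth_less
    proof (intro allI impI)
      fix i j assume "i < j" "j < length (take p xs)"
      then have ij: "i < p" "j < p" "j < t" "i < t" "i < j" using pt by (auto simp: xs_def)
      then show "take p xs ! i < take p xs ! j"
        using mono[of i j] q0[of i] assms(2) by (simp add: xs_def lo)
    qed
    fix a b assume "a \<in> set (drop p xs)" "b \<in> set (take p xs)"
    then obtain i j where "p \<le> i" "i < t" "a = nat (q i - n)" "j < p" "b = nat (q j)"
      using pt by (auto simp: xs_def drop_map take_map hi lo)
    then show "a < b" using top[of i] q0[of j] above[of i] pt by auto
  qed
  moreover have "rotate p xs = drop p xs @ take p xs"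
    using rotate_append[of "take p xs" "drop p xs"] pt by (simp add: xs_def min_absorb2)
  ultimately show ?thesis using that[of p] by (simp add: xs_def)
qed

text \<open>
  The marked positions before reduction modulo \<open>2 ^ l\<close>, in the order of the encoder; they are
  indexed by \<open>m = 0, \<dots>, t - 1\<close>, and the block \<open>x\<^sub>t\<^sub>-\<^sub>m\<close> determines the \<open>m\<close>-th one.
\<close>

definition unwrapped :: "nat \<Rightarrow> nat \<Rightarrow> bool list \<Rightarrow> nat \<Rightarrow> int" where
  "unwrapped l t x m = (\<Sum>u\<le>m. dec (block l t x (t - u)) + 1) - 1"

lemma unwrapped_0: "unwrapped l t x 0 = dec (block l t x t)"
  by (simp add: unwrapped_def)

lemma unwrapped_Suc:
  "unwrapped l t x (Suc m) = unwrapped l t x m + 1 + dec (block l t x (t - Suc m))"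
  by (simp add: unwrapped_def)

lemma unwrapped_less: "i < j \<Longrightarrow> unwrapped l t x i < unwrapped l t x j"
proof (induction j)
  case (Suc j)
  then show ?case
    using dec_bounds(1)[of "block l t x (t - Suc j)"] by (cases "i = j") (auto simp: unwrapped_Suc)
qed simp

text \<open>Loop invariant after \<open>m\<close> rounds: reducing the position in every round
  agrees with reducing the unwrapped position once. For \<open>m = 0\<close> the position is still
  the unreduced start value \<open>- 1\<close>.\<close>

lemma fold_enc_step:
  assumes "m \<le> t"
  shows "case fold (enc_step l t x) (map (\<lambda>u. t - u) [0..<m]) (- 1, replicate (2 ^ l) False)
    of (pos, c) \<Rightarrow>
      pos = (case m of 0 \<Rightarrow> - 1 | Suc m' \<Rightarrow> unwrapped l t x m' mod 2 ^ l) \<and>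
      length c = 2 ^ l \<and> (\<forall>i<2 ^ l. c ! i \<longleftrightarrow> (\<exists>u<m. i = nat (unwrapped l t x u mod 2 ^ l)))"
  using assms
proof (induction m)
  case (Suc m)
  obtain pos c where f:
      "fold (enc_step l t x) (map (\<lambda>u. t - u) [0..<m]) (- 1, replicate (2 ^ l) False) = (pos, c)"
    by fastforce
  have IH: "pos = (case m of 0 \<Rightarrow> - 1 | Suc m' \<Rightarrow> unwrapped l t x m' mod 2 ^ l)" "length c = 2 ^ l"
      "\<forall>i<2 ^ l. c ! i \<longleftrightarrow> (\<exists>u<m. i = nat (unwrapped l t x u mod 2 ^ l))"
    using Suc f by auto
  have pos: "(pos + 1 + dec (block l t x (t - m))) mod 2 ^ l = unwrapped l t x m mod 2 ^ l"
    using IH(1) by (cases m) (simp_all add: unwrapped_0 unwrapped_Suc mod_add_left_eq add.assoc)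
  have lt: "nat (unwrapped l t x m mod 2 ^ l) < 2 ^ l" by (simp add: nat_less_iff)
  have step: "fold (enc_step l t x) (map (\<lambda>u. t - u) [0..<Suc m]) (- 1, replicate (2 ^ l) False)
      = (unwrapped l t x m mod 2 ^ l, c[nat (unwrapped l t x m mod 2 ^ l) := True])"
    by (simp add: f) (simp add: enc_step_def Let_def pos)
  show ?case
    unfolding step using IH(2,3) lt by (auto simp: nth_list_update less_Suc_eq)
qed simp

lemma
  shows length_encode: "length (encode l t x) = 2 ^ l"
    and encode_nth_iff: "i < 2 ^ l \<Longrightarrow>
      encode l t x ! i \<longleftrightarrow> (\<exists>u<t. i = nat (unwrapped l t x u mod 2 ^ l))"
proof -
  have "rev [1..<t+1] = map (\<lambda>u. t - u) [0..<t]"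
    by (rule nth_equalityI) (auto simp del: upt_Suc simp: rev_nth)
  then show "length (encode l t x) = 2 ^ l"
    and "i < 2 ^ l \<Longrightarrow> encode l t x ! i \<longleftrightarrow> (\<exists>u<t. i = nat (unwrapped l t x u mod 2 ^ l))"
    using fold_enc_step[of t t l x] by (auto simp: encode_def split: prod.splits)
qed


section \<open>Estimates for the exponents, and the division of a message into blocks\<close>

text \<open>The right-hand side is the head of \<open>gamma\<close> plus one. The sequence takes the
  value \<open>e\<close> on \<open>s\<close> indices and \<open>e + 1\<close> on the other
  \<open>t - 1 - s\<close>, so this side is \<open>2 ^ e * (2 ^ (r + 1) + s + 2 - 2 * t)\<close>, at
  least \<open>2 * 2 ^ e\<close>. No power in the sum exceeds that, and the one at index
  \<open>1\<close> is only \<open>2 ^ e\<close>.\<close>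

lemma
  assumes "2 \<le> t" and "log 2 (real t) < real l - 1"
  shows fseq_mono: "\<And>i j. 1 \<le> i \<Longrightarrow> i \<le> j \<Longrightarrow> j < t \<Longrightarrow> fseq l t i \<le> fseq l t j"
    and fseq_le_gap: "\<And>i. 1 \<le> i \<Longrightarrow> i < t \<Longrightarrow>
      (2::int) ^ fseq l t i \<le> 2 ^ l - (\<Sum>i=1..<t. 2 ^ fseq l t i)"
    and fseq_1_less_gap: "(2::int) ^ fseq l t 1 < 2 ^ l - (\<Sum>i=1..<t. 2 ^ fseq l t i)"
proof -
  obtain e r s where l: "l = e + r + 1" and s: "1 \<le> s" "s < t" "2 * t \<le> 2 ^ (r + 1) + s"
    and f: "\<And>i. 1 \<le> i \<Longrightarrow> i < t \<Longrightarrow> fseq l t i = (if i \<le> s then e else Suc e)"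
    by (rule fseq_two_level[OF assms], rule that)
  have "(\<Sum>i=1..<t. 2 ^ fseq l t i) = (\<Sum>i=1..<t. if i \<le> s then 2 ^ e else (2::int) * 2 ^ e)"
    by (rule sum.cong) (auto simp: f)
  also have "\<dots> = (\<Sum>i=1..<s+1. 2 ^ e) + (\<Sum>i=s+1..<t. 2 * 2 ^ e)"
    using s by (subst sum.atLeastLessThan_concat[of 1 "s + 1" t, symmetric]) auto
  also have "\<dots> = 2 ^ e * (2 * int t - 2 - int s)"
    using s by (simp add: of_nat_diff algebra_simps)
  finally have "2 ^ l - (\<Sum>i=1..<t. 2 ^ fseq l t i) =
      2 ^ e * (2 ^ (r + 1) + int s + 2 - 2 * int t)"
    by (simp add: l power_add algebra_simps)
  moreover have "2 * int t \<le> 2 ^ (r + 1) + int s"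
    using of_nat_mono[OF s(3), where 'a = int] by simp
  ultimately have gap: "2 ^ e * 2 \<le> 2 ^ l - (\<Sum>i=1..<t. (2::int) ^ fseq l t i)"
    by simp
  show "fseq l t i \<le> fseq l t j" if "1 \<le> i" "i \<le> j" "j < t" for i j
    using that by (simp add: f)
  show "(2::int) ^ fseq l t i \<le> 2 ^ l - (\<Sum>i=1..<t. 2 ^ fseq l t i)" if "1 \<le> i" "i < t" for i
  proof -
    have "(2::int) ^ fseq l t i \<le> 2 ^ e * 2" using that by (simp add: f)
    then show ?thesis using gap by linarith
  qed
  show "(2::int) ^ fseq l t 1 < 2 ^ l - (\<Sum>i=1..<t. 2 ^ fseq l t i)"
  proof -
    have "(2::int) ^ fseq l t 1 = 2 ^ e" using s by (simp add: f)
    moreover have "0 < (2::int) ^ e" by simp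
    ultimately show ?thesis using gap by linarith
  qed
qed

lemma fseq_last: "fseq l t t = l"
  by (simp add: fseq_def)

lemma dec_block_bounds: "0 \<le> dec (block l t x j)" "dec (block l t x j) < 2 ^ fseq l t j"
proof -
  have "dec (block l t x j) < 2 ^ length (block l t x j)" by (rule dec_bounds)
  also have "\<dots> \<le> 2 ^ fseq l t j" by (simp add: block_def)
  finally show "dec (block l t x j) < 2 ^ fseq l t j" .
qed (rule dec_bounds)

lemma sum_top_down: "m \<le> t \<Longrightarrow> (\<Sum>i=t-m+1..t. f i) = (\<Sum>u<m. f (t - u :: nat))"
  by (rule sum.reindex_bij_witness[of _ "\<lambda>u. t - u" "\<lambda>i. t - i"]) auto

lemma length_block:
  assumes "length x = msg_len l t" and "1 \<le> j" and "j \<le> t"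
  shows "length (block l t x j) = fseq l t j"
proof -
  have "(\<Sum>i=j..t. fseq l t i) \<le> msg_len l t"
    unfolding msg_len_def using assms(2) by (intro sum_mono2) auto
  moreover have "(\<Sum>i=j..t. fseq l t i) = fseq l t j + (\<Sum>i=j+1..t. fseq l t i)"
    using assms(3) by (simp add: sum.atLeast_Suc_atMost)
  ultimately show ?thesis using assms(1) by (simp add: block_def)
qed

lemma concat_blocks:
  assumes "length x = msg_len l t"
  shows "concat (map (\<lambda>u. block l t x (t - u)) [0..<t]) = x"
proof -
  \<comment> \<open>Generalised for induction: the first \<open>m\<close> blocks form a prefix of
    \<open>x\<close>.\<close>
  have "concat (map (\<lambda>u. block l t x (t - u)) [0..<m]) = take (\<Sum>u<m. fseq l t (t - u)) x"
    if "m \<le> t" for m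
    using that
  proof (induction m)
    case (Suc m)
    then have "(\<Sum>i=t-m+1..t. fseq l t i) = (\<Sum>u<m. fseq l t (t - u))"
      by (intro sum_top_down) simp
    with Suc show ?case by (simp add: block_def take_add)
  qed simp
  from this[of t] show ?thesis
    using assms sum_top_down[of t t "fseq l t"] by (simp add: msg_len_def)
qed

section \<open>Cyclic gaps of a codeword\<close>

text \<open>This is \<^const>\<open>gamma\<close> when every block has its maximal value.\<close>

definition cyclic_gaps :: "nat \<Rightarrow> nat \<Rightarrow> bool list \<Rightarrow> int list" where
  "cyclic_gaps l t x = (2 ^ l - 1 - (\<Sum>i=1..<t. dec (block l t x i) + 1))
     # map (\<lambda>i. dec (block l t x i)) (rev [1..<t])"

lemma length_cyclic_gaps: "1 \<le> t \<Longrightarrow> length (cyclic_gaps l t x) = t"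
  by (simp add: cyclic_gaps_def)

lemma cyclic_gaps_nth:
  "0 < u \<Longrightarrow> u < t \<Longrightarrow> cyclic_gaps l t x ! u = dec (block l t x (t - u))"
  by (cases u) (simp_all add: cyclic_gaps_def rev_nth Suc_diff_Suc)

text \<open>The blocks below \<open>t\<close> account for the whole distance from the first to the
  last marked position; the rest of the turn is the wrap-around gap plus one.\<close>

lemma unwrapped_last:
  assumes "1 \<le> t"
  shows "unwrapped l t x (t - 1) =
    unwrapped l t x 0 + (\<Sum>i=1..<t. dec (block l t x i) + 1)"
proof -
  have "(\<Sum>u\<le>t-1. dec (block l t x (t - u)) + 1) = (\<Sum>u<t. dec (block l t x (t - u)) + 1)"
    using assms by (intro sum.cong) auto
  also have "\<dots> = (\<Sum>i=1..t. dec (block l t x i) + 1)"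
    using sum_top_down[of t t "\<lambda>i. dec (block l t x i) + 1"] by simp
  also have "\<dots> = (\<Sum>i=1..<t. dec (block l t x i) + 1) + (dec (block l t x t) + 1)"
    using assms by (simp add: sum.last_plus add.commute)
  finally show ?thesis by (simp add: unwrapped_def)
qed

lemma sum_dec_block_le: "(\<Sum>i=1..<t. dec (block l t x i) + 1) \<le> (\<Sum>i=1..<t. 2 ^ fseq l t i)"
  using dec_block_bounds(2) by (intro sum_mono) (simp add: zless_imp_add1_zle)

text \<open>With \<open>sum_dec_block_le\<close> this keeps the marked positions within less than
  one turn, so they stay distinct modulo \<open>2 ^ l\<close>.\<close>

lemma sum_fseq_less:
  assumes "1 \<le> t" and "log 2 (real t) < real l - 1"
  shows "(\<Sum>i=1..<t. 2 ^ fseq l t i) < (2::int) ^ l"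
proof (cases "t = 1")
  case False
  then have "(2::int) ^ fseq l t 1 < 2 ^ l - (\<Sum>i=1..<t. 2 ^ fseq l t i)"
    using assms by (intro fseq_1_less_gap) auto
  moreover have "0 < (2::int) ^ fseq l t 1" by simp
  ultimately show ?thesis by linarith
qed simp

text \<open>Some rotation of the marked positions is strictly increasing, and a strictly increasing
  list is determined by its set of entries.\<close>

lemma ones_encode:
  assumes "1 \<le> t" and "log 2 (real t) < real l - 1"
  obtains s where "ones (encode l t x) = rotate s (map (\<lambda>u. nat (unwrapped l t x u mod 2 ^ l)) [0..<t])"
proof -
  have "unwrapped l t x (t - 1) < unwrapped l t x 0 + 2 ^ l"
    using unwrapped_last[OF assms(1), of l x] sum_dec_block_le[of l t x] sum_fseq_less[OF assms]
    by linarith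
  moreover have "0 \<le> unwrapped l t x 0" "unwrapped l t x 0 < 2 ^ l"
    using dec_block_bounds[of l t x t] by (simp_all add: unwrapped_0 fseq_last)
  ultimately obtain s where
    s: "sorted_wrt (<) (rotate s (map (\<lambda>u. nat (unwrapped l t x u mod 2 ^ l)) [0..<t]))"
    using rotate_sorts_residues[of t "unwrapped l t x" "2 ^ l"] unwrapped_less[of _ _ l t x] by metis
  have "set (ones (encode l t x)) = {i. i < 2 ^ l \<and> encode l t x ! i}"
    by (auto simp: ones_def length_encode)
  also have "\<dots> = (\<lambda>u. nat (unwrapped l t x u mod 2 ^ l)) ` {..<t}"
    by (auto simp: encode_nth_iff nat_less_iff)
  finally have "ones (encode l t x) = rotate s (map (\<lambda>u. nat (unwrapped l t x u mod 2 ^ l)) [0..<t])"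
    using strict_sorted_equal[OF s, of "ones (encode l t x)"]
    by (simp add: ones_def sorted_wrt_filter lessThan_atLeast0)
  then show ?thesis by (rule that)
qed

text \<open>The index \<open>(u + (t - 1)) mod t\<close> is the cyclic predecessor of
  \<open>u\<close>. For \<open>u = 0\<close> the difference is negative and \<open>mod\<close> adds
  one turn, which gives the wrap-around gap; otherwise it is a block value, already below
  \<open>2 ^ l\<close>.\<close>

lemma cyclic_gaps_nth_eq:
  assumes "1 \<le> t" and "log 2 (real t) < real l - 1" and "u < t"
  shows "(unwrapped l t x u - unwrapped l t x ((u + (t - 1)) mod t) - 1) mod 2 ^ l
    = cyclic_gaps l t x ! u"
proof (cases u)
  case 0
  have "(\<Sum>i=1..<t. dec (block l t x i) + 1) < 2 ^ l"
    using sum_dec_block_le[of l t x] sum_fseq_less[OF assms(1,2)] by linarith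
  moreover have "0 \<le> (\<Sum>i=1..<t. dec (block l t x i) + 1)"
    by (intro sum_nonneg) (simp add: dec_block_bounds add_nonneg_nonneg)
  moreover have "(- 1 - S) mod N = N - 1 - S" if "0 \<le> S" "S < N" for S N :: int
  proof -
    have "(- 1 - S + N) mod N = - 1 - S + N"
      using that by (intro mod_pos_pos_trivial) auto
    then show ?thesis by simp
  qed
  ultimately have "(- 1 - (\<Sum>i=1..<t. dec (block l t x i) + 1)) mod 2 ^ l =
      2 ^ l - 1 - (\<Sum>i=1..<t. dec (block l t x i) + 1)"
    by blast
  moreover have "unwrapped l t x 0 - unwrapped l t x (t - 1) - 1 =
      - 1 - (\<Sum>i=1..<t. dec (block l t x i) + 1)"
    using unwrapped_last[OF assms(1), of l x] by linarith
  ultimately show ?thesis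
    using 0 assms(1) by (simp only: cyclic_gaps_def nth_Cons_0 add_0 mod_less diff_less)
next
  case (Suc v)
  have "(u + (t - 1)) mod t = (v + t) mod t" using Suc assms(1) by simp
  also have "\<dots> = v" using Suc assms(3) by simp
  finally have "(u + (t - 1)) mod t = v" .
  moreover have "dec (block l t x (t - u)) < 2 ^ l"
  proof -
    have "dec (block l t x (t - u)) + 1 \<le> (\<Sum>i=1..<t. dec (block l t x i) + 1)"
      using Suc assms(3)
      by (intro member_le_sum[of "t - u" _ "\<lambda>i. dec (block l t x i) + 1"])
        (auto simp: dec_block_bounds add_nonneg_nonneg)
    then show ?thesis
      using sum_dec_block_le[of l t x] sum_fseq_less[OF assms(1,2)] by linarith
  qed
  ultimately show ?thesis
    using Suc assms(3) dec_block_bounds(1)[of l t x "t - u"]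
    by (simp add: unwrapped_Suc cyclic_gaps_nth)
qed


text \<open>Gaps compare cyclic neighbours and see positions only modulo \<open>2 ^ l\<close>, so
  rotating the list of ones rotates the gaps in the same way.\<close>

lemma gaps_encode:
  assumes "1 \<le> t" and "log 2 (real t) < real l - 1"
    and ones: "ones (encode l t x) = rotate s (map (\<lambda>u. nat (unwrapped l t x u mod 2 ^ l)) [0..<t])"
  shows "gaps l t (encode l t x) = rotate s (cyclic_gaps l t x)"
proof (rule nth_equalityI)
  fix m assume "m < length (gaps l t (encode l t x))"
  then have m: "m < t" by (simp add: gaps_def)
  \<comment> \<open>For \<open>m = 0\<close> the integer remainder of \<open>- 1\<close> is
    \<open>t - 1\<close>; adding \<open>t\<close> first yields the same index within the
    naturals.\<close>
  have pred: "nat ((int m - 1) mod int t) = (m + (t - 1)) mod t"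
  proof -
    have "(int m - 1) mod int t = (int m - 1 + int t) mod int t" by simp
    also have "int m - 1 + int t = int (m + (t - 1))" using assms(1) by (simp add: of_nat_diff)
    also have "int (m + (t - 1)) mod int t = int ((m + (t - 1)) mod t)" by (simp only: of_nat_mod)
    finally show ?thesis by (simp only: nat_int)
  qed
  have one: "int (ones (encode l t x) ! v) = unwrapped l t x ((s + v) mod t) mod 2 ^ l" if "v < t" for v
    using that assms(1) by (simp add: ones nth_rotate)
  let ?u = "(s + m) mod t"
  have u: "?u < t" using assms(1) by simp
  have "(s + (m + (t - 1)) mod t) mod t = (?u + (t - 1)) mod t"
    by (simp add: mod_simps add.assoc)
  then have "gaps l t (encode l t x) ! m =
      (unwrapped l t x ?u mod 2 ^ l - unwrapped l t x ((?u + (t - 1)) mod t) mod 2 ^ l - 1) mod 2 ^ l"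
    using m assms(1) by (simp add: gaps_def pred one)
  also have "\<dots> = (unwrapped l t x ?u - unwrapped l t x ((?u + (t - 1)) mod t) - 1) mod 2 ^ l"
    by (intro mod_diff_cong mod_mod_trivial refl)
  also have "\<dots> = cyclic_gaps l t x ! ?u"
    using assms(1,2) u by (rule cyclic_gaps_nth_eq)
  finally show "gaps l t (encode l t x) ! m = rotate s (cyclic_gaps l t x) ! m"
    using m assms(1) by (simp add: nth_rotate length_cyclic_gaps)
qed (use assms(1) in \<open>simp add: gaps_def length_cyclic_gaps\<close>)

section \<open>The exceptional vector and the choice of the anchor\<close>

lemma length_gamma: "1 \<le> t \<Longrightarrow> length (gamma l t) = t"
  by (simp add: gamma_def)

lemma gamma_nth: "0 < u \<Longrightarrow> u < t \<Longrightarrow> gamma l t ! u = 2 ^ fseq l t (t - u) - 1"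
  by (cases u) (simp_all add: gamma_def rev_nth Suc_diff_Suc)

lemma gamma_le_hd:
  assumes "log 2 (real t) < real l - 1" and "u < t"
  shows "gamma l t ! u \<le> gamma l t ! 0"
proof (cases "u = 0")
  case False
  then show ?thesis
    using assms fseq_le_gap[of t l "t - u"] by (simp add: gamma_nth) (simp add: gamma_def)
qed simp

lemma rotate_gamma_eq:
  assumes "1 \<le> t" and "log 2 (real t) < real l - 1" and "rotate m (gamma l t) = gamma l t"
  shows "m mod t = 0"
proof (cases "t = 1")
  case False
  then have t: "2 \<le> t" using assms(1) by simp
  have "sorted_wrt (\<ge>) (gamma l t)"
    unfolding sorted_wrt_iff_nth_less
  proof (intro allI impI)
    fix i j assume ij: "i < j" "j < length (gamma l t)"
    then have j: "j < t" using assms(1) by (simp add: length_gamma)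
    show "gamma l t ! j \<le> gamma l t ! i"
    proof (cases "i = 0")
      case True
      then show ?thesis using gamma_le_hd[OF assms(2) j] by simp
    next
      case False
      have "fseq l t (t - j) \<le> fseq l t (t - i)"
        using ij j False by (intro fseq_mono[OF t assms(2)]) auto
      then have "(2::int) ^ fseq l t (t - j) \<le> 2 ^ fseq l t (t - i)" by simp
      moreover have "gamma l t ! i = 2 ^ fseq l t (t - i) - 1" "gamma l t ! j = 2 ^ fseq l t (t - j) - 1"
        using ij j False by (simp_all add: gamma_nth)
      ultimately show ?thesis by linarith
    qed
  qed
  moreover have "last (gamma l t) < hd (gamma l t)"
  proof -
    have "last (gamma l t) = 2 ^ fseq l t 1 - 1"
      using t gamma_nth[of "t - 1" t l] by (simp add: last_conv_nth length_gamma flip: length_0_conv)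
    then show ?thesis using fseq_1_less_gap[OF t assms(2)] by (simp add: gamma_def)
  qed
  moreover have "gamma l t \<noteq> []" by (simp add: gamma_def)
  ultimately show ?thesis
    using rotate_descending_eq[OF _ _ _ assms(3)] assms(1) by (simp add: length_gamma)
qed simp

text \<open>The heads compare two sums whose terms are already ordered the other way, so the sums
  agree, hence agree termwise, and every block is maximal.\<close>

lemma cyclic_gaps_eq_gamma:
  assumes "cyclic_gaps l t x ! 0 \<le> gamma l t ! 0"
  shows "cyclic_gaps l t x = gamma l t"
proof -
  have eq: "(\<Sum>i=1..<t. dec (block l t x i) + 1) = (\<Sum>i=1..<t. 2 ^ fseq l t i)"
    using assms sum_dec_block_le[of l t x] by (simp add: gamma_def cyclic_gaps_def)
  have "dec (block l t x i) + 1 = 2 ^ fseq l t i" if "i \<in> {1..<t}" for i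
    using sum_mono_inv[OF eq _ that] dec_block_bounds(2) by (simp add: zless_imp_add1_zle)
  then have "dec (block l t x i) = 2 ^ fseq l t i - 1" if "i \<in> {1..<t}" for i
    using that by (metis add_diff_cancel_right')
  then show ?thesis using eq by (simp add: gamma_def cyclic_gaps_def)
qed

lemma add_mod_eq_0_ex:
  fixes t :: nat
  assumes "0 < t"
  shows "\<exists>A<t. (s + A) mod t = 0"
\<comment> \<open>The outer \<open>mod t\<close> in the witness covers the case that
  \<open>t\<close> divides \<open>s\<close>, where \<open>t - s mod t\<close> is \<open>t\<close>
  itself.\<close>
proof (intro exI conjI)
  have "(s + (t - s mod t) mod t) mod t = (s mod t + (t - s mod t)) mod t" by (simp add: mod_simps)
  also have "s mod t + (t - s mod t) = t" using assms by simp
  finally show "(s + (t - s mod t) mod t) mod t = 0" by simp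
qed (use assms in simp)

text \<open>The condition \<open>(s + A) mod t = 0\<close> says that the one with index
  \<open>A\<close> in increasing order is the first position marked by the encoder. Both branches of
  \<open>anchor\<close> single out this index.\<close>

lemma anchor_encode_iff:
  assumes t: "1 \<le> t" and l: "log 2 (real t) < real l - 1"
    and ones: "ones (encode l t x) = rotate s (map (\<lambda>u. nat (unwrapped l t x u mod 2 ^ l)) [0..<t])"
  shows "anchor l t (encode l t x) A \<longleftrightarrow> A < t \<and> (s + A) mod t = 0"
proof -
  let ?H = "cyclic_gaps l t x" and ?g = "gaps l t (encode l t x)"
  have g: "?g = rotate s ?H" by (rule gaps_encode[OF assms])
  have len: "length ?H = t" using t by (rule length_cyclic_gaps)
  show ?thesis
  proof (cases "\<exists>m0<t. rotate m0 ?g = gamma l t")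
    case True
    then obtain m0 where "rotate m0 ?g = gamma l t" by blast
    \<comment> \<open>Rotations preserve the set of entries, so the head of \<open>?H\<close> is an
      entry of \<open>gamma\<close> and cannot exceed its head.\<close>
    then have "set ?H = set (gamma l t)" by (metis g set_rotate)
    moreover have "?H ! 0 \<in> set ?H" using len t by simp
    ultimately obtain u where "u < t" "?H ! 0 = gamma l t ! u"
      using t by (metis in_set_conv_nth length_gamma)
    then have H: "?H = gamma l t" using gamma_le_hd[OF l] by (intro cyclic_gaps_eq_gamma) simp
    have "rotate A ?g = gamma l t \<longleftrightarrow> (s + A) mod t = 0"
      using rotate_gamma_eq[OF t l, of "s + A"] t
      by (auto simp: g H rotate_rotate add.commute length_gamma)
    then show ?thesis using True by (simp add: anchor_def)
  next
    case False
    obtain A0 where A0: "A0 < t" "(s + A0) mod t = 0" using add_mod_eq_0_ex[of t s] t by auto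
    have "?H \<noteq> gamma l t"
    proof
      assume "?H = gamma l t"
      \<comment> \<open>Rotating by \<open>A0\<close> undoes the rotation by
        \<open>s\<close>.\<close>
      then have "rotate A0 ?g = gamma l t" using A0(2) len by (simp add: g rotate_rotate add.commute)
      then show False using False A0(1) by blast
    qed
    then have hd: "gamma l t ! 0 < ?H ! 0" using cyclic_gaps_eq_gamma by (meson not_less)
    \<comment> \<open>Each block value is at most its entry of \<open>gamma\<close>, hence at most
      the head of \<open>gamma\<close>, which is now strictly below the wrap-around gap.\<close>
    have less: "?H ! u < ?H ! 0" if "u < t" "u \<noteq> 0" for u
      using that hd gamma_le_hd[OF l that(1)] dec_block_bounds(2)[of l t x "t - u"]
      by (simp add: cyclic_gaps_nth gamma_nth)
    have nth: "?g ! m = ?H ! ((s + m) mod t)" if "m < t" for m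
      using that len by (simp add: g nth_rotate)
    have "is_arg_max (\<lambda>m. ?g ! m) (\<lambda>m. m < t) A \<longleftrightarrow> A < t \<and> (s + A) mod t = 0"
    proof
      assume max: "is_arg_max (\<lambda>m. ?g ! m) (\<lambda>m. m < t) A"
      then have "A < t" "?g ! A0 \<le> ?g ! A" using A0(1) by (auto simp: is_arg_max_linorder)
      then show "A < t \<and> (s + A) mod t = 0"
        using less[of "(s + A) mod t"] t A0 by (auto simp: nth not_less[symmetric])
    next
      assume A: "A < t \<and> (s + A) mod t = 0"
      have "?H ! ((s + m) mod t) \<le> ?H ! 0" for m
        using less[of "(s + m) mod t"] t by (cases "(s + m) mod t = 0") auto
      with A show "is_arg_max (\<lambda>m. ?g ! m) (\<lambda>m. m < t) A" by (simp add: is_arg_max_linorder nth)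
    qed
    then show ?thesis unfolding anchor_def if_not_P[OF False] .
  qed
qed

section \<open>Correctness of the decoder\<close>

text \<open>From any anchor the decoder reads the first marked position and then the gaps in
  encoding order, which are the block values; expanding them to the block lengths restores
  \<open>x\<close>. The equivalence states both that an output exists and that no other one is
  possible.\<close>

lemma decoder_outputs_encode_iff:
  assumes t: "1 \<le> t" and l: "log 2 (real t) < real l - 1" and x: "length x = msg_len l t"
  shows "decoder_outputs l t (encode l t x) y \<longleftrightarrow> y = x"
proof -
  obtain s where ones:
      "ones (encode l t x) = rotate s (map (\<lambda>u. nat (unwrapped l t x u mod 2 ^ l)) [0..<t])"
    by (rule ones_encode[OF t l])
  let ?out = "\<lambda>A. bin_rep l (int (ones (encode l t x) ! A))
    @ concat (map (\<lambda>i. bin_rep (fseq l t (t - i)) (gaps l t (encode l t x) ! ((A + i) mod t))) [1..<t])"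
  have out: "?out A = x" if A: "A < t" "(s + A) mod t = 0" for A
  proof -
    have len: "length (block l t x (t - u)) = fseq l t (t - u)" if "u < t" for u
      using that by (intro length_block x) auto
    \<comment> \<open>Since \<open>fseq l t t = l\<close>, the first position needs no reduction
      modulo \<open>2 ^ l\<close>.\<close>
    have "int (ones (encode l t x) ! A) = dec (block l t x t)"
      using A dec_block_bounds[of l t x t] by (simp add: ones nth_rotate unwrapped_0 fseq_last)
    then have "bin_rep l (int (ones (encode l t x) ! A)) = block l t x (t - 0)"
      using bin_rep_dec[of "block l t x t"] len[of 0] t by (simp add: fseq_last)
    moreover
    have "bin_rep (fseq l t (t - i)) (gaps l t (encode l t x) ! ((A + i) mod t)) = block l t x (t - i)"
      if "i \<in> set [1..<t]" for i
    proof -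
      have "(s + (A + i) mod t) mod t = ((s + A) mod t + i) mod t" by (simp add: mod_simps add.assoc)
      also have "\<dots> = i" using A that by simp
      finally have "gaps l t (encode l t x) ! ((A + i) mod t) = dec (block l t x (t - i))"
        using that t by (simp add: gaps_encode[OF t l ones] nth_rotate length_cyclic_gaps cyclic_gaps_nth)
      then show ?thesis using bin_rep_dec[of "block l t x (t - i)"] len[of i] that by simp
    qed
    then have "map (\<lambda>i. bin_rep (fseq l t (t - i)) (gaps l t (encode l t x) ! ((A + i) mod t))) [1..<t]
        = map (\<lambda>u. block l t x (t - u)) [1..<t]"
      by (intro map_cong refl)
    ultimately have "?out A = concat (map (\<lambda>u. block l t x (t - u)) (0 # [1..<t]))"
      by (simp only: list.map concat.simps)
    also have "0 # [1..<t] = [0..<t]" using t by (simp add: upt_rec)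
    finally show ?thesis using concat_blocks[OF x] by simp
  qed
  have anchors: "\<exists>A. anchor l t (encode l t x) A"
    using add_mod_eq_0_ex[of t s] t by (auto simp: anchor_encode_iff[OF t l ones])
  have anchor_out: "?out A = x" if "anchor l t (encode l t x) A" for A
    using that by (intro out) (simp_all add: anchor_encode_iff[OF t l ones])
  show ?thesis
  proof
    assume "decoder_outputs l t (encode l t x) y"
    then obtain A where "anchor l t (encode l t x) A" "y = ?out A"
      unfolding decoder_outputs_def by blast
    with anchor_out[of A] show "y = x" by (simp only:)
  next
    assume "y = x"
    obtain A where A: "anchor l t (encode l t x) A" using anchors by blast
    with \<open>y = x\<close> have "y = ?out A" using anchor_out[of A] by (simp only:)
    with A show "decoder_outputs l t (encode l t x) y" unfolding decoder_outputs_def by blast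
  qed
qed

section \<open>Weight, size, and optimality for weight two\<close>

lemma hamming_weight_encode:
  assumes "1 \<le> t" and "log 2 (real t) < real l - 1"
  shows "hamming_weight (encode l t x) = t"
proof -
  obtain s where ones:
      "ones (encode l t x) = rotate s (map (\<lambda>u. nat (unwrapped l t x u mod 2 ^ l)) [0..<t])"
    by (rule ones_encode[OF assms])
  have "{i. i < length (encode l t x) \<and> encode l t x ! i} = set (ones (encode l t x))"
    by (auto simp: ones_def)
  moreover have "distinct (ones (encode l t x))" by (simp add: ones_def)
  ultimately show ?thesis
    unfolding hamming_weight_def by (simp add: distinct_card) (simp add: ones)
qed

lemma card_bvec: "card (bvec k) = 2 ^ k"
  using card_lists_length_eq[of "UNIV :: bool set" k] by (simp add: bvec_def)

text \<open>Words of a common length are determined by their supports, so the code injects into the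
  \<open>w\<close>-subsets of an \<open>n\<close>-set.\<close>

lemma card_constant_weight_code_le:
  assumes "constant_weight_code n w C"
  shows "card C \<le> n choose w"
proof -
  let ?supp = "\<lambda>c::bool list. {i. i < length c \<and> c ! i}"
  have C: "length c = n" "card (?supp c) = w" if "c \<in> C" for c
    using assms that by (auto simp: constant_weight_code_def bvec_def hamming_weight_def)
  have "inj_on ?supp C"
  proof (rule inj_onI)
    fix c d assume cd: "c \<in> C" "d \<in> C" "?supp c = ?supp d"
    then have "c ! i = d ! i" if "i < n" for i using that C(1) by (auto simp: set_eq_iff)
    then show "c = d" using cd by (intro nth_equalityI) (auto simp: C(1))
  qed
  moreover have "?supp ` C \<subseteq> {B. B \<subseteq> {..<n} \<and> card B = w}"
    using C by auto
  ultimately have "card C \<le> card {B. B \<subseteq> {..<n} \<and> card B = w}"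
    by (intro card_inj_on_le) (auto intro: finite_subset[of _ "Pow {..<n}"])
  then show ?thesis by (simp add: n_subsets)
qed

lemma msg_len_2: "msg_len l 2 = l + (l - 2)"
proof -
  have "\<exists>r::nat. 2 = (2::nat) ^ r" by (rule exI[of _ 1]) simp
  moreover have "{1..2} = {1, 2::nat}" by auto
  ultimately show ?thesis by (simp add: msg_len_def fseq_def)
qed

text \<open>The binomial is \<open>2 ^ (l - 1) * (2 ^ l - 1)\<close>, and the second factor lies
  between \<open>2 ^ (l - 1)\<close> and \<open>2 ^ l\<close>, the latter excluded.\<close>

lemma floor_log_choose_2:
  assumes "2 \<le> l"
  shows "\<lfloor>log 2 (real ((2 ^ l) choose 2))\<rfloor> = int (2 * l - 2)"
proof -
  obtain k where l: "l = Suc (Suc k)" using assms by (auto simp: numeral_2_eq_2 dest: le_Suc_ex)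
  have "(2 ^ l) choose 2 = 2 ^ Suc k * (2 ^ l - 1 :: nat)"
    by (simp add: choose_two l)
  moreover have "(2::nat) ^ Suc k \<le> 2 ^ l - 1" "(2::nat) ^ l - 1 < 2 ^ Suc (Suc k)"
    by (simp_all add: l)
  ultimately have "2 ^ Suc k * 2 ^ Suc k \<le> (2 ^ l) choose (2::nat)"
    "(2 ^ l) choose 2 < 2 ^ Suc k * (2::nat) ^ Suc (Suc k)"
    by simp_all
  moreover have "2 * l - 2 = Suc k + Suc k" "2 * l - 2 + 1 = Suc k + Suc (Suc k)"
    by (simp_all add: l)
  ultimately have "2 ^ (2 * l - 2) \<le> (2 ^ l) choose 2" "(2 ^ l) choose 2 < (2::nat) ^ (2 * l - 2 + 1)"
    by (simp_all only: power_add)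
  then have "\<lfloor>log (real 2) (real ((2 ^ l) choose 2))\<rfloor> = int (2 * l - 2)"
    by (intro floor_log_nat_eq_if) simp_all
  then show ?thesis by simp
qed

lemma binary_code_dimension_le:
  assumes "constant_weight_code n w C" and "card C = 2 ^ k"
  shows "int k \<le> \<lfloor>log 2 (real (n choose w))\<rfloor>"
proof -
  have "2 ^ k \<le> n choose w" using card_constant_weight_code_le[OF assms(1)] assms(2) by simp
  then have "2 ^ k \<le> real (n choose w)" by (metis of_nat_le_iff of_nat_numeral of_nat_power)
  moreover from this have "0 < real (n choose w)" by (smt (verit) zero_less_power)
  ultimately have "real k \<le> log 2 (real (n choose w))" by (simp add: le_log_iff powr_realpow)
  then show ?thesis by (simp add: le_floor_iff)
qed

theorem mainTheorem9:
  fixes l t n k :: nat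
  assumes "l \<ge> 3" and "t \<ge> 1" and "log 2 (real t) < real l - 1"
    and "n = 2 ^ l" and "k = (\<Sum>i=1..t. fseq l t i)"
  shows "(\<forall>x\<in>bvec k. encode l t x \<in> bvec n \<and> hamming_weight (encode l t x) = t)
    \<and> inj_on (encode l t) (bvec k)
    \<and> code l t = encode l t ` bvec k
    \<and> constant_weight_code n t (code l t)
    \<and> card (code l t) = 2 ^ k
    \<and> (\<forall>x\<in>bvec k. \<forall>y. decoder_outputs l t (encode l t x) y \<longleftrightarrow> y = x)
    \<and> (\<forall>l'\<ge>3. msg_len l' 2 = 2 * l' - 2
        \<and> int (msg_len l' 2) = \<lfloor>log 2 (real ((2 ^ l') choose 2))\<rfloor>
        \<and> (\<forall>C k'. constant_weight_code (2 ^ l') 2 C \<and> card C = 2 ^ k' \<longrightarrow> k' \<le> msg_len l' 2))"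
proof -
  have k: "k = msg_len l t" using assms(5) by (simp add: msg_len_def)
  have enc: "\<forall>x\<in>bvec k. encode l t x \<in> bvec n \<and> hamming_weight (encode l t x) = t"
    using hamming_weight_encode[OF assms(2,3)] assms(4) by (simp add: bvec_def length_encode)
  have dec: "\<forall>x\<in>bvec k. \<forall>y. decoder_outputs l t (encode l t x) y \<longleftrightarrow> y = x"
    using decoder_outputs_encode_iff[OF assms(2,3)] by (simp add: bvec_def k)
  \<comment> \<open>Messages with the same codeword have the same decoder outputs, hence
    coincide.\<close>
  then have inj: "inj_on (encode l t) (bvec k)" by (metis inj_onI)
  have code: "code l t = encode l t ` bvec k" by (simp add: code_def k)
  have "constant_weight_code n t (code l t)" using enc by (auto simp: constant_weight_code_def code)
  moreover have "card (code l t) = 2 ^ k" by (simp add: code card_image[OF inj] card_bvec)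
  moreover have "msg_len l' 2 = 2 * l' - 2
      \<and> int (msg_len l' 2) = \<lfloor>log 2 (real ((2 ^ l') choose 2))\<rfloor>
      \<and> (\<forall>C k'. constant_weight_code (2 ^ l') 2 C \<and> card C = 2 ^ k' \<longrightarrow> k' \<le> msg_len l' 2)"
    if "l' \<ge> 3" for l'
  proof -
    have "msg_len l' 2 = 2 * l' - 2" using that by (simp add: msg_len_2)
    moreover from this have "int (msg_len l' 2) = \<lfloor>log 2 (real ((2 ^ l') choose 2))\<rfloor>"
      using floor_log_choose_2[of l'] that by simp
    ultimately show ?thesis using binary_code_dimension_le by (metis of_nat_le_iff)
  qed
  ultimately show ?thesis using enc dec inj code by blast
qed

end
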